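(* Let $q$ be a power of $2$. Then the Erdős–Rényi graph $ER_q$ has a triangle-free induced subgraph with $q(q+1)/2$ vertices which contains no absolute points.
   Context: For $q$ even, $ER_q$ is the polarity graph of the pseudo polarity $\perp$ of $\mathrm{PG}(2,q)$, which (up to projective equivalence) maps the point $(x_1,x_2,x_3)$ to the line $x_1X_1+x_3X_2+x_2X_3=0$: its vertices are the points of $\mathrm{PG}(2,q)$, and two distinct points $P_1,P_2$ are adjacent iff $P_1 \in P_2^\perp$. A point $P$ is absolute if $P \in P^\perp$ (for this polarity the absolute points are those of the line $X_1=0$). *)

theory Defs
  imports "HOL-Analysis.Analysis" "Graph_Theory.Graph_Theory"
begin

text \<open>The plane PG(2,q), where 'a is the field with q elements: points and lines are the subspaces
  of the coordinate space of dimension 1 and 2, and incidence is inclusion. The constants of the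
  locale interpretation vec refer to scalars in 'a.\<close>

definition pg_points :: "('a::field ^ 3) set set" where
  "pg_points = {P. vec.subspace P \<and> vec.dim P = 1}"

definition pg_lines :: "('a::field ^ 3) set set" where
  "pg_lines = {L. vec.subspace L \<and> vec.dim L = 2}"

text \<open>The image of the point spanned by x is the line with equation
  x1 X1 + x3 X2 + x2 X3 = 0. Quantifying over all vectors of the point avoids choosing a
  representative.\<close>

definition pseudo_polarity :: "('a::field ^ 3) set \<Rightarrow> ('a ^ 3) set" where
  "pseudo_polarity P = {y. \<forall>x\<in>P. x$1 * y$1 + x$3 * y$2 + x$2 * y$3 = 0}"

definition absolute_point :: "('a::field ^ 3) set \<Rightarrow> bool" where
  "absolute_point P \<longleftrightarrow> P \<in> pg_points \<and> P \<subseteq> pseudo_polarity P"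

text \<open>Graphs are symmetric digraphs, as in the locale \<^locale>\<open>graph\<close>.\<close>

definition ER_graph :: "('a::field ^ 3) set pair_pre_digraph" where
  "ER_graph = \<lparr> pverts = pg_points,
     parcs = {(P, Q). P \<in> pg_points \<and> Q \<in> pg_points \<and> P \<noteq> Q \<and> P \<subseteq> pseudo_polarity Q} \<rparr>"

definition triangle_free :: "('v, 'e) pre_digraph \<Rightarrow> bool" where
  "triangle_free G \<longleftrightarrow>
     \<not> (\<exists>u\<in>verts G. \<exists>v\<in>verts G. \<exists>w\<in>verts G. u \<noteq> v \<and> v \<noteq> w \<and> u \<noteq> w \<and>
          u \<rightarrow>\<^bsub>G\<^esub> v \<and> v \<rightarrow>\<^bsub>G\<^esub> w \<and> w \<rightarrow>\<^bsub>G\<^esub> u)"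

lemma pg_point_span:
  fixes P :: "('a::field ^ 3) set"
  shows "P \<in> pg_points \<longleftrightarrow> (\<exists>x. x \<noteq> 0 \<and> P = vec.span {x})"
proof
  assume P: "P \<in> pg_points"
  then have s: "vec.subspace P" and d: "vec.dim P = 1" by (auto simp: pg_points_def)
  obtain B where B: "B \<subseteq> P" "vec.independent B" "P \<subseteq> vec.span B" "card B = vec.dim P"
    using vec.basis_exists[of P] by metis
  obtain x where x: "B = {x}" using B(4) d by (metis card_1_singletonE)
  have "x \<noteq> 0" using B(2) x by auto
  moreover have "P = vec.span {x}"
    using B x s by (metis subset_antisym vec.span_minimal)
  ultimately show "\<exists>x. x \<noteq> 0 \<and> P = vec.span {x}" by blast
next
  assume "\<exists>x. x \<noteq> 0 \<and> P = vec.span {x}"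
  then obtain x where x: "x \<noteq> 0" "P = vec.span {x}" by blast
  have "vec.dim (vec.span {x}) = 1"
    using x(1) by (simp add: vec.dim_eq_card_independent)
  then show "P \<in> pg_points" by (simp add: pg_points_def x)
qed

lemma pseudo_polarity_span:
  "pseudo_polarity (vec.span {x}) = {y. x$1 * y$1 + x$3 * y$2 + x$2 * y$3 = (0::'a::field)}"
proof -
  have "k * x$1 * y$1 + k * x$3 * y$2 + k * x$2 * y$3
      = k * (x$1 * y$1 + x$3 * y$2 + x$2 * y$3)" for k :: 'a and y :: "'a ^ 3"
    by (simp add: algebra_simps)
  then show ?thesis
    by (auto simp: pseudo_polarity_def vec.span_singleton dest: spec[of _ 1])
qed

lemma ER_graph_graph: "graph (with_proj (ER_graph :: ('a::{field,finite} ^ 3) set pair_pre_digraph))"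
proof -
  have "P \<subseteq> pseudo_polarity Q \<Longrightarrow> Q \<subseteq> pseudo_polarity P" for P Q :: "('a ^ 3) set"
    by (fastforce simp: pseudo_polarity_def subset_iff algebra_simps)
  then show ?thesis
    by unfold_locales (auto simp: ER_graph_def arc_to_ends_def symmetric_def sym_def)
qed

lemma absolute_point_iff:
  fixes P :: "('a::field ^ 3) set"
  assumes "(2::'a) = 0" and "P \<in> pg_points"
  shows "absolute_point P \<longleftrightarrow> P \<subseteq> {y. y$1 = 0}"
proof -
  obtain x where x: "P = vec.span {x}" using assms(2) pg_point_span by blast
  have "x$3 * x$2 + x$2 * x$3 = 2 * (x$2 * x$3)" by (simp add: algebra_simps)
  then have *: "x$3 * x$2 + x$2 * x$3 = 0" using assms(1) by simp
  have "x \<in> pseudo_polarity P \<longleftrightarrow> x$1 = 0"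
    unfolding x pseudo_polarity_span mem_Collect_eq add.assoc * by simp
  moreover have "x \<in> P" by (simp add: x vec.span_base)
  moreover have "P \<subseteq> pseudo_polarity P" if "x$1 = 0"
    unfolding x pseudo_polarity_span
  proof
    fix y assume "y \<in> vec.span {x}"
    then obtain k where k: "y = k *s x" by (auto simp: vec.span_singleton)
    have "x$3 * (k * x$2) + x$2 * (k * x$3) = k * (x$3 * x$2 + x$2 * x$3)"
      by (simp add: algebra_simps)
    then show "y \<in> {y. x$1 * y$1 + x$3 * y$2 + x$2 * y$3 = 0}" using * that k by simp
  qed
  moreover have "P \<subseteq> {y. y$1 = 0}" if "x$1 = 0"
    using that by (auto simp: x vec.span_singleton)
  ultimately show ?thesis using assms(2) by (auto simp: absolute_point_def)
qed

lemma pseudo_polarity_line: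
  fixes P :: "('a::field ^ 3) set"
  assumes "P \<in> pg_points"
  shows "pseudo_polarity P \<in> pg_lines"
proof -
  obtain x where x: "x \<noteq> 0" "P = vec.span {x}" using assms pg_point_span by blast
  define g where "g = (\<lambda>y::'a^3. x$1 * y$1 + x$3 * y$2 + x$2 * y$3)"
  let ?L = "pseudo_polarity P"
  have ker: "?L = {y. g y = 0}"
    by (simp add: x pseudo_polarity_span g_def)
  have g: "g (y + z) = g y + g z" "g (k *s y) = k * g y" for y z k
    by (simp_all add: g_def algebra_simps)
  have g0: "g 0 = 0" by (simp add: g_def)
  have sub: "vec.subspace ?L"
    unfolding ker by (rule vec.subspaceI) (simp_all add: g g0)
  have "x$1 \<noteq> 0 \<or> x$2 \<noteq> 0 \<or> x$3 \<noteq> 0"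
    using x(1) by (auto simp: vec_eq_iff forall_3)
  moreover have "g (axis 1 1) = x$1" "g (axis 2 1) = x$3" "g (axis 3 1) = x$2"
    by (simp_all add: g_def axis_def)
  ultimately obtain v where v: "g v \<noteq> 0" by metis
  then have v0: "v \<noteq> 0" using g0 by auto
  have "y \<in> {a + b | a b. a \<in> ?L \<and> b \<in> vec.span {v}}" for y
  proof -
    let ?b = "(g y / g v) *s v"
    have "g (y + (- (g y / g v)) *s v) = 0" using v by (simp only: g) simp
    then have "y + (- (g y / g v)) *s v \<in> ?L" by (simp add: ker)
    moreover have "?b \<in> vec.span {v}" by (auto simp: vec.span_singleton)
    moreover have "y = (y + (- (g y / g v)) *s v) + ?b" by (simp add: vec_eq_iff)
    ultimately show ?thesis by blast
  qed
  then have "{a + b | a b. a \<in> ?L \<and> b \<in> vec.span {v}} = UNIV" by blast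
  moreover have "?L \<inter> vec.span {v} = {0}"
    using v by (auto simp: ker g g0 vec.span_singleton intro: exI[of _ 0])
  moreover have "vec.dim (vec.span {v}) = 1"
    using v0 by (simp add: vec.dim_eq_card_independent)
  ultimately have "vec.dim (UNIV :: ('a^3) set) + vec.dim {0::'a^3} = vec.dim ?L + 1"
    using vec.dim_sums_Int[OF sub vec.subspace_span, of "{v}"] by simp
  moreover have "vec.dim {0::'a^3} = 0"
    by (rule vec.dim_unique[of "{}"]) (auto simp: vec.independent_empty)
  moreover have "vec.dim (UNIV :: ('a^3) set) = 3"
    by (simp add: vec.dim_UNIV vec.dimension_def card_cart_basis)
  ultimately show ?thesis using sub by (simp add: pg_lines_def)
qed

end

theory Submission
  imports Defs
begin

text \<open>The non-absolute points are the points (1,a,b), and two of them are adjacent iff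
  a b' + a' b = 1. As the characteristic is 2, the third vertex (1,c,d) of a triangle through
  (1,a,b) and (1,a',b') satisfies (c,d) = (a+a', b+b'), whence c d = a b + a' b' + 1.
  Let K be an additive subgroup of index 2 of the field with 1 not in K. Then the points (1,a,b)
  with a b in K induce a triangle-free graph, and there are q + (q - 1) q / 2 of them.\<close>

text \<open>Translation by 1 permutes the field, so comparing the sum of all elements with its
  translate gives \<open>CARD('a)\<close> = 0 in the field; a vanishing power of 2 forces 2 =
  0.\<close>

lemma two_eq_zero_if_card_power_two:
  assumes "CARD('a::{field,finite}) = 2 ^ h"
  shows "(2::'a) = 0"
proof -
  have "(\<Sum>x\<in>(UNIV::'a set). x) = (\<Sum>x\<in>UNIV. x + 1)"
    by (rule sum.reindex_bij_witness[of _ "\<lambda>x. x + 1" "\<lambda>x. x - 1"]) auto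
  then have "of_nat (CARD('a)) = (0::'a)"
    by (simp add: sum.distrib)
  then show ?thesis by (simp add: assms)
qed

text \<open>Among the additive subgroups that avoid 1, a maximal one works: maximality forces its
  complement to be the single coset 1 + K.\<close>

lemma index_two_additive_subgroup_avoiding_one:
  assumes two: "(2::'a::{field,finite}) = 0"
  obtains K :: "'a::{field,finite} set" where "\<And>x y. x \<in> K \<Longrightarrow> y \<in> K \<Longrightarrow> x + y \<in> K"
    and "0 \<in> K" "1 \<notin> K" "2 * card K = CARD('a)"
proof -
  have dbl: "x + x = 0" for x :: 'a
    using two by (metis mult_2 mult_zero_left)
  \<comment> \<open>Every element is its own negative here, so 0 and closure under addition already
    make a subgroup.\<close>
  define G where "G = (\<lambda>K::'a set. 0 \<in> K \<and> 1 \<notin> K \<and> (\<forall>x\<in>K. \<forall>y\<in>K. x + y \<in> K))"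
  have "finite (Collect G)" "{0} \<in> Collect G" by (simp_all add: G_def)
  then obtain K where K: "G K" and max: "\<And>L. G L \<Longrightarrow> K \<subseteq> L \<Longrightarrow> L = K"
    using finite_has_maximal[of "Collect G"] by (metis empty_iff mem_Collect_eq)
  have add: "x + y \<in> K" if "x \<in> K" "y \<in> K" for x y
    using K that by (auto simp: G_def)
  have zero: "0 \<in> K" and one: "1 \<notin> K" using K by (auto simp: G_def)
  \<comment> \<open>If x and 1 + x both lay outside K, then K together with x + K would be a
    strictly larger subgroup still avoiding 1, since 1 = x + k means k = 1 + x.\<close>
  have shift: "1 + x \<in> K" if "x \<notin> K" for x
  proof (rule ccontr)
    assume n: "1 + x \<notin> K"
    let ?L = "K \<union> (+) x ` K"
    have "1 \<notin> (+) x ` K"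
    proof
      assume "1 \<in> (+) x ` K"
      then obtain k where k: "k \<in> K" "1 = x + k" by auto
      have "1 + x = k + (x + x)" by (subst k(2)) (simp add: algebra_simps)
      then show False using n k(1) by (simp add: dbl)
    qed
    moreover have "u + v \<in> ?L" if uv: "u \<in> ?L" "v \<in> ?L" for u v
    proof -
      have mixed: "a + (x + b) \<in> ?L" "(x + b) + a \<in> ?L" if "a \<in> K" "b \<in> K" for a b
      proof -
        have "x + (a + b) \<in> ?L" using add that by blast
        then show "a + (x + b) \<in> ?L" "(x + b) + a \<in> ?L"
          by (simp_all only: ac_simps)
      qed
      \<comment> \<open>As x + x = 0, two elements of x + K add up to an element of K, so two cosets
        suffice for closure.\<close>
      have both: "(x + a) + (x + b) \<in> ?L" if "a \<in> K" "b \<in> K" for a b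
      proof -
        have "(x + a) + (x + b) = (x + x) + (a + b)" by (simp only: ac_simps)
        also have "\<dots> = a + b" by (simp only: dbl add_0)
        finally show ?thesis using add[OF that] by (simp only: UnI1)
      qed
      show ?thesis
        using uv by (elim UnE imageE) (simp_all only: add UnI1 mixed both)
    qed
    ultimately have "G ?L" using zero one by (simp add: G_def)
    then have "?L = K" using max by blast
    then have "x + 0 \<in> K" using zero by blast
    then show False using that by simp
  qed
  have "- K = (+) 1 ` K"
  proof
    show "- K \<subseteq> (+) 1 ` K"
    proof
      fix x assume "x \<in> - K"
      then have "1 + x \<in> K" using shift by simp
      moreover have "x = 1 + (1 + x)" using dbl[of 1] by (simp flip: add.assoc)
      ultimately show "x \<in> (+) 1 ` K" by blast
    qed
    show "(+) 1 ` K \<subseteq> - K"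
    proof clarsimp
      fix k assume k: "k \<in> K" "1 + k \<in> K"
      have "(1 + k) + k = 1" by (simp add: add.assoc dbl)
      then show False using add[OF k(2) k(1)] one by (simp only:)
    qed
  qed
  then have "card (- K) = card K" by (simp add: card_image)
  moreover have "card (- K) = CARD('a) - card K" by (simp add: Compl_eq_Diff_UNIV card_Diff_subset)
  moreover have "card K \<le> CARD('a)" by (simp add: card_mono)
  ultimately have "2 * card K = CARD('a)" by linarith
  then show thesis using that add zero one by blast
qed

text \<open>Count by the first factor: for a = 0 every b qualifies because 0 is in K, while for
  nonzero a multiplication by a maps the admissible b bijectively onto K.\<close>

lemma card_product_in:
  fixes K :: "'a::{field,finite} set"
  assumes "0 \<in> K"
  shows "card {(a, b). a * b \<in> K} = CARD('a) + (CARD('a) - 1) * card K"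
proof -
  have "{(a, b). a * b \<in> K} = (SIGMA a:UNIV. {b. a * b \<in> K})" by auto
  then have "card {(a, b). a * b \<in> K} = (\<Sum>a\<in>UNIV. card {b. a * b \<in> K})"
    by simp
  also have "\<dots> = card {b. 0 * b \<in> K} + (\<Sum>a\<in>UNIV - {0}. card {b. a * b \<in> K})"
    by (rule sum.remove) auto
  also have "(\<Sum>a\<in>UNIV - {0}. card {b. a * b \<in> K}) = (\<Sum>a\<in>UNIV - {0::'a}. card K)"
  proof (rule sum.cong)
    fix a :: 'a assume "a \<in> UNIV - {0}"
    then have "bij_betw ((*) a) {b. a * b \<in> K} K"
      by (intro bij_betwI[where g = "\<lambda>k. k / a"]) auto
    then show "card {b. a * b \<in> K} = card K" by (rule bij_betw_same_card)
  qed simp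
  finally show ?thesis using assms by (simp add: card_Diff_singleton)
qed

text \<open>Fixing the first coordinate as 1 singles out one representative per point, and keeps the
  point off the line of absolute points.\<close>

definition affine_point :: "'a::field \<times> 'a \<Rightarrow> ('a ^ 3) set" where
  "affine_point u = vec.span {vector [1, fst u, snd u]}"

lemma affine_point_in_pg_points: "affine_point u \<in> pg_points"
proof -
  have "vector [1, fst u, snd u] \<noteq> (0 :: 'a ^ 3)"
    by (simp add: vec_eq_iff forall_3 vector_3)
  then show ?thesis unfolding affine_point_def pg_point_span by blast
qed

lemma inj_affine_point: "inj affine_point"
proof (rule injI)
  fix u v :: "'a \<times> 'a"
  assume "affine_point u = affine_point v"
  then have "vector [1, fst u, snd u] \<in> vec.span {vector [1, fst v, snd v] :: 'a ^ 3}"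
    unfolding affine_point_def by (metis singletonI vec.span_base)
  then obtain k where "vector [1, fst u, snd u] = k *s (vector [1, fst v, snd v] :: 'a ^ 3)"
    by (auto simp: vec.span_singleton)
  then show "u = v" by (simp add: vec_eq_iff forall_3 vector_3 prod_eq_iff)
qed

lemma affine_point_not_absolute:
  assumes "(2::'a::field) = 0"
  shows "\<not> absolute_point (affine_point (u :: 'a \<times> 'a))"
proof -
  have "vector [1, fst u, snd u] \<in> affine_point u"
    by (simp add: affine_point_def vec.span_base)
  then have "\<not> affine_point u \<subseteq> {y. y$1 = 0}"
    by (auto simp: subset_iff intro!: exI[of _ "vector [1, fst u, snd u]"] simp: vector_3)
  then show ?thesis using absolute_point_iff[OF assms affine_point_in_pg_points] by blast
qed

lemma affine_point_adjacent:
  assumes "affine_point u \<subseteq> pseudo_polarity (affine_point v)"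
  shows "1 + snd v * fst u + fst v * snd u = 0"
proof -
  have "vector [1, fst u, snd u] \<in> affine_point u"
    by (simp add: affine_point_def vec.span_base)
  then have "vector [1, fst u, snd u] \<in> pseudo_polarity (affine_point v)"
    using assms by blast
  then show ?thesis
    by (simp add: affine_point_def pseudo_polarity_span vector_3)
qed

text \<open>Two vertices of a triangle determine the third as the intersection of their polar lines,
  and its coordinates turn out to be sums. The mixed terms of (a + c) (b + d) are then governed by
  the edge equation \<open>uv\<close>.\<close>

lemma triangle_product:
  fixes a b c d e f :: "'a::field"
  assumes two: "(2::'a) = 0"
    and uv: "1 + d * a + c * b = 0" and vw: "1 + f * c + e * d = 0" and wu: "1 + b * e + a * f = 0"
  shows "e * f + a * b + c * d = 1"
proof -
  \<comment> \<open>Each edge equation is weighted, up to sign, by a coordinate of the opposite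
    vertex; the cubic terms then cancel except for an even multiple of a c f.\<close>
  have "e - (a + c) = e * (1 + d * a + c * b) - a * (1 + f * c + e * d) - c * (1 + b * e + a * f)
      + 2 * (a * c * f)"
    by (simp add: algebra_simps)
  then have e: "e = a + c" unfolding uv vw wu two by simp
  have "f - (b + d) = f * (1 + d * a + c * b) - d * (1 + b * e + a * f) - b * (1 + f * c + e * d)
      + 2 * (b * d * e)"
    by (simp add: algebra_simps)
  then have f: "f = b + d" unfolding uv vw wu two by simp
  have "e * f + a * b + c * d - 1 = (1 + d * a + c * b) + 2 * (a * b + c * d - 1)"
    unfolding e f by (simp add: algebra_simps)
  then show ?thesis unfolding uv two by simp
qed

theorem theorem3p1:
  fixes q h :: nat
  assumes "q = 2 ^ h" and "CARD('a::{field,finite}) = q"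
  shows "\<exists>H. induced_subgraph H (with_proj (ER_graph :: ('a ^ 3) set pair_pre_digraph)) \<and>
           triangle_free H \<and>
           card (verts H) = q * (q + 1) div 2 \<and>
           (\<forall>P\<in>verts H. \<not> absolute_point P)"
proof -
  have two: "(2::'a) = 0" using two_eq_zero_if_card_power_two assms by metis
  obtain K :: "'a set" where add: "\<And>x y. x \<in> K \<Longrightarrow> y \<in> K \<Longrightarrow> x + y \<in> K"
    and zero: "0 \<in> K" and one: "1 \<notin> K" and cardK: "2 * card K = CARD('a)"
    using index_two_additive_subgroup_avoiding_one[OF two] by blast
  let ?G = "with_proj (ER_graph :: ('a ^ 3) set pair_pre_digraph)"
  define S where "S = affine_point ` {(a, b). a * b \<in> K}"
  define H where "H = ?G \<restriction> S"
  interpret graph ?G by (rule ER_graph_graph)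
  have vH: "verts H = S" by (simp add: H_def)
  have "S \<subseteq> verts ?G"
    using affine_point_in_pg_points by (auto simp: S_def ER_graph_def)
  then have "induced_subgraph H ?G"
    unfolding H_def by (rule induced_induce)
  moreover have "triangle_free H"
    unfolding triangle_free_def
  proof clarify
    fix P Q R
    assume "P \<in> verts H" "Q \<in> verts H" "R \<in> verts H"
      and adj: "P \<rightarrow>\<^bsub>H\<^esub> Q" "Q \<rightarrow>\<^bsub>H\<^esub> R" "R \<rightarrow>\<^bsub>H\<^esub> P"
    then obtain a b c d e f where
      P: "P = affine_point (a, b)" "a * b \<in> K" and
      Q: "Q = affine_point (c, d)" "c * d \<in> K" and
      R: "R = affine_point (e, f)" "e * f \<in> K"
      by (auto simp: vH S_def)
    have polar: "X \<subseteq> pseudo_polarity Y" if "X \<rightarrow>\<^bsub>H\<^esub> Y" for X Y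
      using that by (auto simp: H_def ER_graph_def arcs_ends_def arc_to_ends_def)
    have "e * f + a * b + c * d = 1"
      using adj[THEN polar] unfolding P Q R
      by (intro triangle_product[OF two]) (auto dest!: affine_point_adjacent)
    \<comment> \<open>All three products lie in K, hence so does their sum, which is 1.\<close>
    then show False using add P(2) Q(2) R(2) one by metis
  qed
  moreover have "card (verts H) = q * (q + 1) div 2"
  proof -
    have "card (verts H) = q + (q - 1) * card K"
      unfolding vH S_def assms(2)[symmetric] card_product_in[OF zero, symmetric]
      by (rule card_image) (rule inj_on_subset[OF inj_affine_point subset_UNIV])
    moreover have "q + (q - 1) * card K = q * (q + 1) div 2"
    proof -
      \<comment> \<open>With q = 2 (k + 1) the truncated subtraction disappears and the division is
        exact: both sides equal (k + 1) (2 k + 3).\<close>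
      obtain k where k: "card K = Suc k"
        using zero by (metis card_0_eq empty_iff finite not0_implies_Suc)
      have "q = 2 * Suc k" using cardK assms(2) k by simp
      then show ?thesis by (simp add: k algebra_simps)
    qed
    ultimately show ?thesis by simp
  qed
  moreover have "\<forall>P\<in>verts H. \<not> absolute_point P"
    using affine_point_not_absolute[OF two] by (auto simp: vH S_def)
  ultimately show ?thesis by blast
qed

end
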